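(* Let $D$ be a finite distributive lattice. Then the subset $Q = D$ of $D$ is representable; that is, there is a finite lattice $L$ and a lattice isomorphism $\psi \colon \operatorname{Con} L \to D$ such that $\psi(\operatorname{Princ} L) = D$.
   Context: For a finite lattice $L$, $\operatorname{Con} L$ denotes the congruence lattice of $L$. For $a,b \in L$, $\operatorname{con}(a,b)$ denotes the smallest congruence of $L$ under which $a$ and $b$ are congruent; congruences of this form are called principal. $\operatorname{Princ} L \subseteq \operatorname{Con} L$ denotes the set of all principal congruences of $L$. A subset $Q$ of a finite distributive lattice $D$ is (principal congruence) representable if there is a finite lattice $L$ and an isomorphism $\psi \colon \operatorname{Con} L \to D$ with $\psi(\operatorname{Princ} L) = Q$. *)

theory Defs
  imports "HOL-Algebra.Complete_Lattice"
begin

section \<open>Finite and distributive lattices\<close>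

text \<open>The library's \<^locale>\<open>lattice\<close> admits the empty carrier, which the usual
  convention for lattices excludes; \<open>finite_lattice\<close> therefore asks for a nonempty one.\<close>

locale finite_lattice = lattice +
  assumes finite_carrier: "finite (carrier L)"
    and carrier_nonempty: "carrier L \<noteq> {}"

locale distributive_lattice = lattice +
  assumes meet_join_distrib:
    "\<lbrakk>x \<in> carrier L; y \<in> carrier L; z \<in> carrier L\<rbrakk>
      \<Longrightarrow> x \<sqinter> (y \<squnion> z) = (x \<sqinter> y) \<squnion> (x \<sqinter> z)"

locale finite_distributive_lattice = finite_lattice + distributive_lattice

definition lattice_iso ::
    "('a, 'c) gorder_scheme \<Rightarrow> ('b, 'd) gorder_scheme \<Rightarrow> ('a \<Rightarrow> 'b) \<Rightarrow> bool" where
  "lattice_iso X Y f \<longleftrightarrow>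
     bij_betw f (carrier X) (carrier Y) \<and> join_pres X Y f \<and> meet_pres X Y f"


section \<open>The congruence lattice and principal congruences\<close>

definition lattice_congruence :: "('a, 'c) gorder_scheme \<Rightarrow> ('a \<times> 'a) set \<Rightarrow> bool" where
  "lattice_congruence L \<theta> \<longleftrightarrow>
     equiv (carrier L) \<theta> \<and>
     (\<forall>a b c d. (a, b) \<in> \<theta> \<and> (c, d) \<in> \<theta> \<longrightarrow>
        (a \<squnion>\<^bsub>L\<^esub> c, b \<squnion>\<^bsub>L\<^esub> d) \<in> \<theta> \<and> (a \<sqinter>\<^bsub>L\<^esub> c, b \<sqinter>\<^bsub>L\<^esub> d) \<in> \<theta>)"

definition Con :: "('a, 'c) gorder_scheme \<Rightarrow> ('a \<times> 'a) set gorder" where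
  "Con L = \<lparr>carrier = {\<theta>. lattice_congruence L \<theta>}, eq = (=), le = (\<subseteq>)\<rparr>"

text \<open>The least congruence identifying \<open>a\<close> and \<open>b\<close>; see \<open>con_least\<close> below.\<close>

definition con :: "('a, 'c) gorder_scheme \<Rightarrow> 'a \<Rightarrow> 'a \<Rightarrow> ('a \<times> 'a) set" where
  "con L a b = \<Inter>{\<theta>. lattice_congruence L \<theta> \<and> (a, b) \<in> \<theta>}"

definition Princ :: "('a, 'c) gorder_scheme \<Rightarrow> ('a \<times> 'a) set set" where
  "Princ L = {con L a b | a b. a \<in> carrier L \<and> b \<in> carrier L}"


section \<open>Representable subsets\<close>

text \<open>HOL cannot quantify existentially over the type of the elements of \<open>L\<close>. Taking the
  elements of \<open>L\<close> to be natural numbers loses nothing, since every finite lattice is isomorphic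
  to one of this kind; see \<open>finite_lattice_nat_copy\<close> below.\<close>

definition representable :: "('d, 'c) gorder_scheme \<Rightarrow> 'd set \<Rightarrow> bool" where
  "representable D Q \<longleftrightarrow>
     Q \<subseteq> carrier D \<and>
     (\<exists>(L :: nat gorder) \<psi>.
        finite_lattice L \<and> lattice_iso (Con L) D \<psi> \<and> \<psi> ` Princ L = Q)"


section \<open>Basic facts\<close>

lemma lattice_congruence_full:
  assumes "lattice L"
  shows "lattice_congruence L (carrier L \<times> carrier L)"
proof -
  interpret lattice L by fact
  show ?thesis
    by (auto simp: lattice_congruence_def equiv_def refl_on_def sym_def trans_def)
qed

lemma lattice_congruence_Inter:
  assumes "\<Theta> \<noteq> {}" and "\<And>\<theta>. \<theta> \<in> \<Theta> \<Longrightarrow> lattice_congruence L \<theta>"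
  shows "lattice_congruence L (\<Inter>\<Theta>)"
proof -
  have *: "equiv (carrier L) \<theta>" if "\<theta> \<in> \<Theta>" for \<theta>
    using assms(2)[OF that] by (simp add: lattice_congruence_def)
  obtain \<theta>\<^sub>0 where "\<theta>\<^sub>0 \<in> \<Theta>"
    using assms(1) by blast
  then have "\<Inter>\<Theta> \<subseteq> carrier L \<times> carrier L"
    using equiv_type[OF *] by blast
  moreover have "refl_on (carrier L) (\<Inter>\<Theta>)"
    using * by (simp add: equiv_def refl_on_def)
  moreover have "sym (\<Inter>\<Theta>)"
    using * by (intro symI) (simp, meson equivE symD)
  moreover have "trans (\<Inter>\<Theta>)"
    using * by (intro transI) (simp, meson equivE transD)
  ultimately have "equiv (carrier L) (\<Inter>\<Theta>)"
    by (simp add: equiv_def)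
  then show ?thesis
    using assms(2) by (simp add: lattice_congruence_def)
qed

lemma con_least:
  assumes "lattice L" "a \<in> carrier L" "b \<in> carrier L"
  shows "least (Con L) (con L a b) {\<theta> \<in> carrier (Con L). (a, b) \<in> \<theta>}"
proof -
  have "lattice_congruence L (con L a b)"
    unfolding con_def
    using lattice_congruence_full[OF assms(1)] assms(2,3)
    by (intro lattice_congruence_Inter) auto
  then show ?thesis
    by (auto simp: least_def Con_def con_def)
qed

lemma lattice_Con:
  assumes "lattice L"
  shows "lattice (Con L)"
proof -
  interpret po: partial_order "Con L"
    by unfold_locales (auto simp: Con_def)
  show ?thesis
  proof
    fix \<theta> \<eta> assume A: "\<theta> \<in> carrier (Con L)" "\<eta> \<in> carrier (Con L)"
    then have sub: "\<theta> \<subseteq> carrier L \<times> carrier L" "\<eta> \<subseteq> carrier L \<times> carrier L"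
      by (auto simp: Con_def lattice_congruence_def dest!: equiv_type)
    let ?S = "{\<xi>. lattice_congruence L \<xi> \<and> \<theta> \<subseteq> \<xi> \<and> \<eta> \<subseteq> \<xi>}"
    have "lattice_congruence L (\<Inter>?S)"
      using lattice_congruence_full[OF assms] sub by (intro lattice_congruence_Inter) auto
    then have "least (Con L) (\<Inter>?S) (Upper (Con L) {\<theta>, \<eta>})"
      using A by (auto simp: least_def Upper_def Con_def)
    then show "\<exists>s. least (Con L) s (Upper (Con L) {\<theta>, \<eta>})" ..
    have "lattice_congruence L (\<Inter>{\<theta>, \<eta>})"
      using A by (intro lattice_congruence_Inter) (auto simp: Con_def)
    then have "greatest (Con L) (\<theta> \<inter> \<eta>) (Lower (Con L) {\<theta>, \<eta>})"
      using A by (auto simp: greatest_def Lower_def Con_def)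
    then show "\<exists>s. greatest (Con L) s (Lower (Con L) {\<theta>, \<eta>})" ..
  qed
qed

lemma finite_lattice_nat_copy:
  fixes L :: "('a, 'c) gorder_scheme" (structure)
  assumes "finite_lattice L"
  shows "\<exists>(M :: nat gorder) f. finite_lattice M \<and> lattice_iso L M f"
proof -
  interpret finite_lattice L by fact
  obtain f :: "'a \<Rightarrow> nat" where inj: "inj_on f (carrier L)"
    using finite_imp_inj_to_nat_seg[OF finite_carrier] by blast
  define g where "g = the_inv_into (carrier L) f"
  have gf: "g (f x) = x" if "x \<in> carrier L" for x
    unfolding g_def using inj that by (rule the_inv_into_f_f)
  define M :: "nat gorder" where
    "M = \<lparr>carrier = f ` carrier L, eq = (=), le = (\<lambda>x y. g x \<sqsubseteq> g y)\<rparr>"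
  interpret M: partial_order M
  proof
    fix x y z
    assume "x \<sqsubseteq>\<^bsub>M\<^esub> y" "y \<sqsubseteq>\<^bsub>M\<^esub> z" "x \<in> carrier M" "y \<in> carrier M" "z \<in> carrier M"
    then show "x \<sqsubseteq>\<^bsub>M\<^esub> z"
      unfolding M_def by (auto simp: gf intro: le_trans)
  qed (auto simp: M_def gf dest: le_antisym)
  have fM: "f x \<in> carrier M" if "x \<in> carrier L" for x
    using that by (simp add: M_def)
  have le_M: "f x \<sqsubseteq>\<^bsub>M\<^esub> f y \<longleftrightarrow> x \<sqsubseteq> y" if "x \<in> carrier L" "y \<in> carrier L" for x y
    using that by (simp add: M_def gf)
  have lub: "least M (f (x \<squnion> y)) (Upper M {f x, f y})"
    if "x \<in> carrier L" "y \<in> carrier L" for x y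
  proof (rule least_UpperI)
    fix z assume "z \<in> Upper M {f x, f y}"
    then have "z \<in> carrier M" "f x \<sqsubseteq>\<^bsub>M\<^esub> z" "f y \<sqsubseteq>\<^bsub>M\<^esub> z"
      using that fM by (simp_all add: Upper_def)
    moreover from \<open>z \<in> carrier M\<close> obtain w where "w \<in> carrier L" "z = f w"
      by (auto simp: M_def)
    ultimately have "w \<in> carrier L" "z = f w" "x \<sqsubseteq> w" "y \<sqsubseteq> w"
      using that le_M by simp_all
    then show "f (x \<squnion> y) \<sqsubseteq>\<^bsub>M\<^esub> z"
      using that join_le by (simp add: le_M)
  qed (use that join_left join_right in \<open>auto simp: le_M fM\<close>)
  have glb: "greatest M (f (x \<sqinter> y)) (Lower M {f x, f y})"
    if "x \<in> carrier L" "y \<in> carrier L" for x y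
  proof (rule greatest_LowerI)
    fix z assume "z \<in> Lower M {f x, f y}"
    then have "z \<in> carrier M" "z \<sqsubseteq>\<^bsub>M\<^esub> f x" "z \<sqsubseteq>\<^bsub>M\<^esub> f y"
      using that fM by (simp_all add: Lower_def)
    moreover from \<open>z \<in> carrier M\<close> obtain w where "w \<in> carrier L" "z = f w"
      by (auto simp: M_def)
    ultimately have "w \<in> carrier L" "z = f w" "w \<sqsubseteq> x" "w \<sqsubseteq> y"
      using that le_M by simp_all
    then show "z \<sqsubseteq>\<^bsub>M\<^esub> f (x \<sqinter> y)"
      using that meet_le by (simp add: le_M)
  qed (use that meet_left meet_right in \<open>auto simp: le_M fM\<close>)
  have "lattice M"
  proof
    fix u v assume "u \<in> carrier M" "v \<in> carrier M"
    then obtain x y where "x \<in> carrier L" "y \<in> carrier L" "u = f x" "v = f y"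
      by (auto simp: M_def)
    then show "\<exists>s. least M s (Upper M {u, v})" "\<exists>s. greatest M s (Lower M {u, v})"
      using lub glb by blast+
  qed
  then interpret M: lattice M .
  have "finite_lattice M"
    using finite_carrier carrier_nonempty by unfold_locales (auto simp: M_def)
  moreover have "f (x \<squnion> y) = f x \<squnion>\<^bsub>M\<^esub> f y" if "x \<in> carrier L" "y \<in> carrier L" for x y
  proof -
    have "least M (f x \<squnion>\<^bsub>M\<^esub> f y) (Upper M {f x, f y})"
      unfolding join_def[of M] using that by (intro M.sup_of_two_least) (simp_all add: M_def)
    from M.weak_least_unique[OF lub[OF that] this] show ?thesis
      by (simp add: M.eq_is_equal)
  qed
  moreover have "f (x \<sqinter> y) = f x \<sqinter>\<^bsub>M\<^esub> f y" if "x \<in> carrier L" "y \<in> carrier L" for x y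
  proof -
    have "greatest M (f x \<sqinter>\<^bsub>M\<^esub> f y) (Lower M {f x, f y})"
      unfolding meet_def[of M] using that by (intro M.inf_of_two_greatest) (simp_all add: M_def)
    from M.weak_greatest_unique[OF glb[OF that] this] show ?thesis
      by (simp add: M.eq_is_equal)
  qed
  moreover have "bij_betw f (carrier L) (carrier M)"
    using inj by (simp add: bij_betw_def M_def)
  ultimately show ?thesis
    using \<open>lattice M\<close> lattice_axioms
    unfolding lattice_iso_def join_pres_def meet_pres_def by blast
qed

end

theory Submission
  imports Defs
begin

text \<open>Let \<open>P\<close> be the poset of join-irreducible elements of \<open>D\<close>. Represent \<open>D\<close> by the lattice of
  those subsets of \<open>P\<close> times a three-element set that, whenever they contain \<open>(q, j)\<close> together
  with some \<open>(q, i)\<close>, \<open>i \<noteq> j\<close>, or with some \<open>(p, i)\<close>, \<open>q < p\<close>, contain the whole fibre of \<open>q\<close>.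
  The fibres are copies of the simple lattice \<open>M\<^sub>3\<close>, and collapsing the fibre of \<open>p\<close> forces the
  fibre of each \<open>q < p\<close> to collapse. Hence the congruences are the relations ``equal outside
  \<open>I\<close>'' for the down-sets \<open>I\<close> of \<open>P\<close>. Such a congruence is generated by identifying the empty
  set with the union of the fibres over \<open>I\<close>, so it is principal.\<close>


section \<open>Lattice isomorphisms\<close>

text \<open>Joins and meets are determined by the order. By surjectivity a join or meet in
  \<open>Y\<close> is some \<open>f z\<close>, so its inequalities pull back to \<open>X\<close>,
  where the universal property applies. Later isomorphisms therefore need only an order
  check.\<close>

lemma order_iso_imp_lattice_iso:
  fixes X :: "('a, 'c) gorder_scheme" and Y :: "('b, 'd) gorder_scheme"
  assumes "lattice X" "lattice Y" and bij: "bij_betw f (carrier X) (carrier Y)"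
    and le: "\<And>x y. \<lbrakk>x \<in> carrier X; y \<in> carrier X\<rbrakk> \<Longrightarrow> f x \<sqsubseteq>\<^bsub>Y\<^esub> f y \<longleftrightarrow> x \<sqsubseteq>\<^bsub>X\<^esub> y"
  shows "lattice_iso X Y f"
proof -
  interpret X: lattice X by fact
  interpret Y: lattice Y by fact
  have fY: "f x \<in> carrier Y" if "x \<in> carrier X" for x
    using bij that by (rule bij_betw_apply)
  have surj: "\<exists>x\<in>carrier X. y = f x" if "y \<in> carrier Y" for y
    using bij that by (auto simp: bij_betw_def)
  have "f (x \<squnion>\<^bsub>X\<^esub> y) = f x \<squnion>\<^bsub>Y\<^esub> f y" if xy: "x \<in> carrier X" "y \<in> carrier X" for x y
  proof (rule Y.le_antisym)
    obtain z where z: "z \<in> carrier X" "f x \<squnion>\<^bsub>Y\<^esub> f y = f z"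
      using surj xy fY by (meson Y.join_closed)
    have "f x \<sqsubseteq>\<^bsub>Y\<^esub> f z" "f y \<sqsubseteq>\<^bsub>Y\<^esub> f z"
      using Y.join_left[of "f x" "f y"] Y.join_right[of "f x" "f y"] xy fY z by auto
    then show "f (x \<squnion>\<^bsub>X\<^esub> y) \<sqsubseteq>\<^bsub>Y\<^esub> f x \<squnion>\<^bsub>Y\<^esub> f y"
      using xy z by (simp add: le X.join_le)
    show "f x \<squnion>\<^bsub>Y\<^esub> f y \<sqsubseteq>\<^bsub>Y\<^esub> f (x \<squnion>\<^bsub>X\<^esub> y)"
      using xy fY X.join_left X.join_right by (intro Y.join_le) (auto simp: le)
  qed (use xy fY in auto)
  moreover have "f (x \<sqinter>\<^bsub>X\<^esub> y) = f x \<sqinter>\<^bsub>Y\<^esub> f y" if xy: "x \<in> carrier X" "y \<in> carrier X" for x y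
  proof (rule Y.le_antisym)
    obtain z where z: "z \<in> carrier X" "f x \<sqinter>\<^bsub>Y\<^esub> f y = f z"
      using surj xy fY by (meson Y.meet_closed)
    have "f z \<sqsubseteq>\<^bsub>Y\<^esub> f x" "f z \<sqsubseteq>\<^bsub>Y\<^esub> f y"
      using Y.meet_left[of "f x" "f y"] Y.meet_right[of "f x" "f y"] xy fY z by auto
    then show "f x \<sqinter>\<^bsub>Y\<^esub> f y \<sqsubseteq>\<^bsub>Y\<^esub> f (x \<sqinter>\<^bsub>X\<^esub> y)"
      using xy z by (simp add: le X.meet_le)
    show "f (x \<sqinter>\<^bsub>X\<^esub> y) \<sqsubseteq>\<^bsub>Y\<^esub> f x \<sqinter>\<^bsub>Y\<^esub> f y"
      using xy fY X.meet_left X.meet_right by (intro Y.meet_le) (auto simp: le)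
  qed (use xy fY in auto)
  ultimately show ?thesis
    using assms(1,2) bij unfolding lattice_iso_def join_pres_def meet_pres_def by blast
qed

lemma lattice_iso_inv_into:
  assumes "lattice_iso L M f"
  shows "lattice_iso M L (inv_into (carrier L) f)"
proof -
  let ?g = "inv_into (carrier L) f"
  have bij: "bij_betw f (carrier L) (carrier M)" and lat: "lattice L" "lattice M"
    and j: "\<And>x y. \<lbrakk>x \<in> carrier L; y \<in> carrier L\<rbrakk> \<Longrightarrow> f (x \<squnion>\<^bsub>L\<^esub> y) = f x \<squnion>\<^bsub>M\<^esub> f y"
    and m: "\<And>x y. \<lbrakk>x \<in> carrier L; y \<in> carrier L\<rbrakk> \<Longrightarrow> f (x \<sqinter>\<^bsub>L\<^esub> y) = f x \<sqinter>\<^bsub>M\<^esub> f y"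
    using assms by (auto simp: lattice_iso_def join_pres_def meet_pres_def)
  interpret L: lattice L by fact
  have gL: "?g u \<in> carrier L" "f (?g u) = u" if "u \<in> carrier M" for u
    using bij that by (auto simp: bij_betw_def inv_into_into f_inv_into_f)
  have gf: "?g (f x) = x" if "x \<in> carrier L" for x
    using bij that by (simp add: bij_betw_def)
  have "?g (u \<squnion>\<^bsub>M\<^esub> v) = ?g u \<squnion>\<^bsub>L\<^esub> ?g v" if "u \<in> carrier M" "v \<in> carrier M" for u v
    using gf[of "?g u \<squnion>\<^bsub>L\<^esub> ?g v"] j[of "?g u" "?g v"] gL that by simp
  moreover have "?g (u \<sqinter>\<^bsub>M\<^esub> v) = ?g u \<sqinter>\<^bsub>L\<^esub> ?g v" if "u \<in> carrier M" "v \<in> carrier M" for u v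
    using gf[of "?g u \<sqinter>\<^bsub>L\<^esub> ?g v"] m[of "?g u" "?g v"] gL that by simp
  ultimately show ?thesis
    using lat bij_betw_inv_into[OF bij]
    unfolding lattice_iso_def join_pres_def meet_pres_def by blast
qed

section \<open>Transport of congruences along lattice isomorphisms\<close>

lemma lattice_congruence_subset:
  "lattice_congruence L \<theta> \<Longrightarrow> \<theta> \<subseteq> carrier L \<times> carrier L"
  by (auto simp: lattice_congruence_def dest!: equiv_type)

lemma lattice_congruence_image:
  assumes iso: "lattice_iso L M f" and cong: "lattice_congruence L \<theta>"
  shows "lattice_congruence M (map_prod f f ` \<theta>)"
proof -
  have inj: "inj_on f (carrier L)" and im: "f ` carrier L = carrier M"
    and j: "\<And>x y. \<lbrakk>x \<in> carrier L; y \<in> carrier L\<rbrakk> \<Longrightarrow> f (x \<squnion>\<^bsub>L\<^esub> y) = f x \<squnion>\<^bsub>M\<^esub> f y"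
    and m: "\<And>x y. \<lbrakk>x \<in> carrier L; y \<in> carrier L\<rbrakk> \<Longrightarrow> f (x \<sqinter>\<^bsub>L\<^esub> y) = f x \<sqinter>\<^bsub>M\<^esub> f y"
    using iso by (auto simp: lattice_iso_def join_pres_def meet_pres_def bij_betw_def)
  have sub: "\<And>x y. (x, y) \<in> \<theta> \<Longrightarrow> x \<in> carrier L \<and> y \<in> carrier L"
    using lattice_congruence_subset[OF cong] by auto
  have refl: "\<And>x. x \<in> carrier L \<Longrightarrow> (x, x) \<in> \<theta>"
    and sym: "\<And>x y. (x, y) \<in> \<theta> \<Longrightarrow> (y, x) \<in> \<theta>"
    and trans: "\<And>x y z. \<lbrakk>(x, y) \<in> \<theta>; (y, z) \<in> \<theta>\<rbrakk> \<Longrightarrow> (x, z) \<in> \<theta>"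
    and comp: "\<And>a b c d. \<lbrakk>(a, b) \<in> \<theta>; (c, d) \<in> \<theta>\<rbrakk> \<Longrightarrow>
      (a \<squnion>\<^bsub>L\<^esub> c, b \<squnion>\<^bsub>L\<^esub> d) \<in> \<theta> \<and> (a \<sqinter>\<^bsub>L\<^esub> c, b \<sqinter>\<^bsub>L\<^esub> d) \<in> \<theta>"
    using cong unfolding lattice_congruence_def equiv_def
    by (auto dest: refl_onD symD transD)
  let ?R = "map_prod f f ` \<theta>"
  have R: "(u, v) \<in> ?R \<longleftrightarrow> (\<exists>x y. (x, y) \<in> \<theta> \<and> u = f x \<and> v = f y)" for u v
    by force
  have "?R \<subseteq> carrier M \<times> carrier M"
    using sub im by auto
  moreover have "refl_on (carrier M) ?R"
    unfolding refl_on_def R im[symmetric] using refl by blast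
  moreover have "sym ?R"
    by (rule symI) (unfold R, blast intro: sym)
  \<comment> \<open>The two pairs share an image as middle term; injectivity of \<open>f\<close>
    identifies its two preimages, so transitivity of \<open>\<theta>\<close> applies.\<close>
  moreover have "trans ?R"
    by (rule transI) (unfold R, metis trans sub inj inj_onD)
  moreover have "(a \<squnion>\<^bsub>M\<^esub> c, b \<squnion>\<^bsub>M\<^esub> d) \<in> ?R \<and> (a \<sqinter>\<^bsub>M\<^esub> c, b \<sqinter>\<^bsub>M\<^esub> d) \<in> ?R"
    if abcd: "(a, b) \<in> ?R" "(c, d) \<in> ?R" for a b c d
  proof -
    obtain a' b' c' d' where *: "(a', b') \<in> \<theta>" "(c', d') \<in> \<theta>"
      "a = f a'" "b = f b'" "c = f c'" "d = f d'"
      using abcd unfolding R by blast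
    then have "a \<squnion>\<^bsub>M\<^esub> c = f (a' \<squnion>\<^bsub>L\<^esub> c')" "b \<squnion>\<^bsub>M\<^esub> d = f (b' \<squnion>\<^bsub>L\<^esub> d')"
      "a \<sqinter>\<^bsub>M\<^esub> c = f (a' \<sqinter>\<^bsub>L\<^esub> c')" "b \<sqinter>\<^bsub>M\<^esub> d = f (b' \<sqinter>\<^bsub>L\<^esub> d')"
      using sub[OF *(1)] sub[OF *(2)] by (simp_all add: j m)
    then show ?thesis
      using comp[OF *(1,2)] unfolding R by blast
  qed
  ultimately show ?thesis
    by (auto simp: lattice_congruence_def equiv_def)
qed

lemma map_prod_inv_into_image:
  assumes "inj_on f A" "\<theta> \<subseteq> A \<times> A"
  shows "map_prod (inv_into A f) (inv_into A f) ` map_prod f f ` \<theta> = \<theta>"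
proof -
  have "map_prod (inv_into A f) (inv_into A f) (map_prod f f z) = z" if "z \<in> \<theta>" for z
    using that assms by (cases z) (auto simp: inv_into_f_f)
  then show ?thesis
    by (simp add: image_image cong: image_cong)
qed

lemma map_prod_image_inv_into:
  assumes "f ` A = B" "\<eta> \<subseteq> B \<times> B"
  shows "map_prod f f ` map_prod (inv_into A f) (inv_into A f) ` \<eta> = \<eta>"
proof -
  have "map_prod f f (map_prod (inv_into A f) (inv_into A f) z) = z" if "z \<in> \<eta>" for z
    using that assms by (cases z) (auto simp: f_inv_into_f)
  then show ?thesis
    by (simp add: image_image cong: image_cong)
qed

lemma bij_betw_Con_image:
  assumes iso: "lattice_iso L M f"
  shows "bij_betw ((`) (map_prod f f)) (carrier (Con L)) (carrier (Con M))"
proof (rule bij_betw_byWitness[where f' = "(`) (map_prod (inv_into (carrier L) f) (inv_into (carrier L) f))"])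
  have bij: "inj_on f (carrier L)" "f ` carrier L = carrier M"
    using iso by (auto simp: lattice_iso_def bij_betw_def)
  show "\<forall>\<theta>\<in>carrier (Con L). map_prod (inv_into (carrier L) f) (inv_into (carrier L) f) ` map_prod f f ` \<theta> = \<theta>"
    using lattice_congruence_subset[of L] bij
    unfolding Con_def by (simp add: map_prod_inv_into_image)
  show "\<forall>\<theta>\<in>carrier (Con M). map_prod f f ` map_prod (inv_into (carrier L) f) (inv_into (carrier L) f) ` \<theta> = \<theta>"
    using lattice_congruence_subset[of M] bij
    unfolding Con_def by (simp add: map_prod_image_inv_into)
qed (use lattice_congruence_image[OF iso] lattice_congruence_image[OF lattice_iso_inv_into[OF iso]] in
      \<open>auto simp: Con_def\<close>)

text \<open>Inclusion in \<open>\<eta>\<close> amounts to the equation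
  \<open>\<theta> \<union> \<eta> = \<eta>\<close>, and a map injective on
  \<open>A \<times> A\<close> preserves and reflects equality of subsets.\<close>

lemma map_prod_image_subset_iff:
  assumes "inj_on f A" "\<theta> \<subseteq> A \<times> A" "\<eta> \<subseteq> A \<times> A"
  shows "map_prod f f ` \<theta> \<subseteq> map_prod f f ` \<eta> \<longleftrightarrow> \<theta> \<subseteq> \<eta>"
  using inj_on_image_eq_iff[OF map_prod_inj_on[OF assms(1) assms(1)], of "\<theta> \<union> \<eta>" \<eta>] assms(2,3)
  unfolding image_Un subset_Un_eq[of _ \<eta>] subset_Un_eq[of _ "map_prod f f ` \<eta>"] by simp

text \<open>The image of \<open>con L a b\<close> is a congruence of \<open>M\<close> relating
  \<open>f a\<close> to \<open>f b\<close>, which bounds the left side. Conversely, each competing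
  congruence of \<open>M\<close> pulls back along the inverse of \<open>f\<close> to one containing
  \<open>con L a b\<close>; pushing forward again gives the other inclusion.\<close>

lemma con_image:
  assumes iso: "lattice_iso L M f" and ab: "a \<in> carrier L" "b \<in> carrier L"
  shows "con M (f a) (f b) = map_prod f f ` con L a b"
proof (rule antisym)
  have inj: "inj_on f (carrier L)" and im: "f ` carrier L = carrier M" and "lattice L"
    using iso by (auto simp: lattice_iso_def bij_betw_def join_pres_def)
  have "lattice_congruence L (con L a b)" "(a, b) \<in> con L a b"
    using con_least[OF \<open>lattice L\<close> ab] by (auto simp: least_def Con_def)
  then show "con M (f a) (f b) \<subseteq> map_prod f f ` con L a b"
    unfolding con_def[of M] using lattice_congruence_image[OF iso] by blast
  show "map_prod f f ` con L a b \<subseteq> con M (f a) (f b)"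
    unfolding con_def[of M]
  proof (rule Inter_greatest)
    fix \<eta> assume "\<eta> \<in> {\<theta>. lattice_congruence M \<theta> \<and> (f a, f b) \<in> \<theta>}"
    then have \<eta>: "lattice_congruence M \<eta>" "(f a, f b) \<in> \<eta>" by auto
    let ?g = "inv_into (carrier L) f"
    have "lattice_congruence L (map_prod ?g ?g ` \<eta>)"
      using \<eta>(1) lattice_iso_inv_into[OF iso] by (rule lattice_congruence_image[rotated])
    moreover have "(a, b) \<in> map_prod ?g ?g ` \<eta>"
      using \<eta>(2) inj ab by (force simp: inv_into_f_f)
    ultimately have "con L a b \<subseteq> map_prod ?g ?g ` \<eta>"
      by (auto simp: con_def)
    then have "map_prod f f ` con L a b \<subseteq> map_prod f f ` map_prod ?g ?g ` \<eta>"
      by blast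
    then show "map_prod f f ` con L a b \<subseteq> \<eta>"
      using map_prod_image_inv_into[OF im lattice_congruence_subset[OF \<eta>(1)]] by simp
  qed
qed

lemma Princ_image:
  assumes iso: "lattice_iso L M f"
  shows "Princ M = (`) (map_prod f f) ` Princ L"
proof -
  have "f ` carrier L = carrier M"
    using iso by (auto simp: lattice_iso_def bij_betw_def)
  then have "Princ M = {con M u v |u v. u \<in> f ` carrier L \<and> v \<in> f ` carrier L}"
    by (simp add: Princ_def)
  also have "\<dots> = (`) (map_prod f f) ` Princ L"
  proof (intro subset_antisym subsetI)
    fix \<eta> assume "\<eta> \<in> {con M u v |u v. u \<in> f ` carrier L \<and> v \<in> f ` carrier L}"
    then obtain a b where ab: "a \<in> carrier L" "b \<in> carrier L" "\<eta> = con M (f a) (f b)"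
      by (elim CollectE exE conjE imageE) simp
    then have "con L a b \<in> Princ L"
      unfolding Princ_def by blast
    with ab show "\<eta> \<in> (`) (map_prod f f) ` Princ L"
      by (simp add: con_image[OF iso])
  next
    fix \<eta> assume "\<eta> \<in> (`) (map_prod f f) ` Princ L"
    then obtain a b where ab: "a \<in> carrier L" "b \<in> carrier L" "\<eta> = map_prod f f ` con L a b"
      by (auto simp: Princ_def)
    then have "\<eta> = con M (f a) (f b)"
      by (simp add: con_image[OF iso])
    with ab show "\<eta> \<in> {con M u v |u v. u \<in> f ` carrier L \<and> v \<in> f ` carrier L}"
      by blast
  qed
  finally show ?thesis .
qed

lemma lattice_iso_Con_image:
  assumes iso: "lattice_iso L M f"
  shows "lattice_iso (Con L) (Con M) ((`) (map_prod f f))"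
proof (rule order_iso_imp_lattice_iso)
  have lat: "lattice L" "lattice M" and inj: "inj_on f (carrier L)"
    using iso by (auto simp: lattice_iso_def bij_betw_def join_pres_def)
  then show "lattice (Con L)" "lattice (Con M)"
    by (auto intro: lattice_Con)
  fix \<theta> \<eta> assume "\<theta> \<in> carrier (Con L)" "\<eta> \<in> carrier (Con L)"
  then show "map_prod f f ` \<theta> \<sqsubseteq>\<^bsub>Con M\<^esub> map_prod f f ` \<eta> \<longleftrightarrow> \<theta> \<sqsubseteq>\<^bsub>Con L\<^esub> \<eta>"
    using map_prod_image_subset_iff[OF inj lattice_congruence_subset lattice_congruence_subset]
    by (simp add: Con_def)
qed (rule bij_betw_Con_image[OF iso])

lemma lattice_iso_comp:
  assumes "lattice_iso X Y f" "lattice_iso Y Z g"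
  shows "lattice_iso X Z (g \<circ> f)"
  using assms bij_betw_trans[of f "carrier X" "carrier Y" g "carrier Z"]
  unfolding lattice_iso_def join_pres_def meet_pres_def
  by (auto simp: bij_betw_apply)

text \<open>Frees the construction from carriers of natural numbers: \<open>L\<close> is copied to a
  lattice \<open>M\<close> on \<open>nat\<close>, and the composite isomorphism from
  \<open>D\<close> through \<open>Con L\<close> to \<open>Con M\<close> is inverted to obtain the
  map that \<open>representable\<close> asks for.\<close>

lemma representableI:
  fixes L :: "('a, 'c) gorder_scheme"
  assumes L: "finite_lattice L" and \<phi>: "lattice_iso D (Con L) \<phi>"
    and Q: "Q \<subseteq> carrier D" "\<phi> ` Q = Princ L"
  shows "representable D Q"
proof -
  obtain M :: "nat gorder" and f where M: "finite_lattice M" and f: "lattice_iso L M f"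
    using finite_lattice_nat_copy[OF L] by blast
  define h where "h = (`) (map_prod f f) \<circ> \<phi>"
  have h: "lattice_iso D (Con M) h"
    unfolding h_def using \<phi> lattice_iso_Con_image[OF f] by (rule lattice_iso_comp)
  have "h ` Q = Princ M"
    unfolding h_def image_comp[symmetric] Q(2) Princ_image[OF f] ..
  then have "inv_into (carrier D) h ` Princ M = Q"
    using h Q(1) inv_into_image_cancel[of h "carrier D" Q]
    by (auto simp: lattice_iso_def bij_betw_def)
  then show ?thesis
    unfolding representable_def using M Q(1) lattice_iso_inv_into[OF h] by blast
qed


section \<open>The representing lattice\<close>

text \<open>Abstracts the join-irreducible elements of \<open>D\<close> with their strict order.
  Irreflexivity ensures that no point triggers itself, so that singletons are closed.\<close>

locale finite_irreflexive =
  fixes P :: "'p set" and below :: "'p \<Rightarrow> 'p \<Rightarrow> bool"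
  assumes finite_P: "finite P"
    and irrefl: "\<not> below p p"
begin

text \<open>A set containing both \<open>x\<close> and \<open>y\<close> must contain the fibre of
  \<open>fst y\<close>: they are either two distinct atoms of one copy of M_3, or \<open>x\<close>
  lies in a fibre above that of \<open>y\<close>.\<close>

definition triggers :: "'p \<times> Enum.finite_3 \<Rightarrow> 'p \<times> Enum.finite_3 \<Rightarrow> bool" where
  "triggers x y \<longleftrightarrow> below (fst y) (fst x) \<or> fst x = fst y \<and> x \<noteq> y"

text \<open>A single round of filling. By \<open>fill_fill\<close> it is already a closure operator,
  and \<open>L\<close> consists of its closed sets.\<close>

definition fill :: "('p \<times> Enum.finite_3) set \<Rightarrow> ('p \<times> Enum.finite_3) set" where
  "fill S = S \<union> {y. \<exists>x\<in>S. \<exists>z\<in>S. fst z = fst y \<and> triggers x z}"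

definition L :: "('p \<times> Enum.finite_3) set gorder" where
  "L = \<lparr>carrier = {S. S \<subseteq> P \<times> UNIV \<and> fill S = S}, eq = (=), le = (\<subseteq>)\<rparr>"

definition down_set :: "'p set \<Rightarrow> bool" where
  "down_set I \<longleftrightarrow> I \<subseteq> P \<and> (\<forall>p\<in>I. \<forall>q\<in>P. below q p \<longrightarrow> q \<in> I)"

definition agree_outside :: "'p set \<Rightarrow> (('p \<times> Enum.finite_3) set \<times> ('p \<times> Enum.finite_3) set) set" where
  "agree_outside I = {(A, B). A \<in> carrier L \<and> B \<in> carrier L \<and> (\<forall>x. fst x \<notin> I \<longrightarrow> (x \<in> A \<longleftrightarrow> x \<in> B))}"

lemma agree_outside_iff:
  "(A, B) \<in> agree_outside I \<longleftrightarrow>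
     A \<in> carrier L \<and> B \<in> carrier L \<and> (\<forall>x. fst x \<notin> I \<longrightarrow> (x \<in> A \<longleftrightarrow> x \<in> B))"
  by (simp add: agree_outside_def)

section \<open>The closure operator \<open>fill\<close>\<close>

lemma fill_mono: "A \<subseteq> B \<Longrightarrow> fill A \<subseteq> fill B"
  by (auto simp: fill_def)

lemma subset_fill: "A \<subseteq> fill A"
  by (auto simp: fill_def)

lemma in_fillD: "y \<in> fill A \<Longrightarrow> \<exists>x\<in>A. fst x = fst y"
  unfolding fill_def by blast

text \<open>Only fibres already met get filled, so if \<open>x\<close> and \<open>z\<close> trigger
  a new point \<open>y\<close> in the second round, \<open>A\<close> has points in the fibres of
  both. These do not trigger, hence \<open>x\<close> and \<open>z\<close> are distinct and lie in
  one fibre, that of \<open>y\<close>. Nothing was filled there in the first round, so both lie in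
  \<open>A\<close>, and \<open>y\<close> was not new.\<close>

lemma fill_fill: "fill (fill A) = fill A"
proof (rule antisym[OF _ subset_fill], rule subsetI, rule ccontr)
  fix y assume "y \<in> fill (fill A)" and y: "y \<notin> fill A"
  then obtain x z where xz: "x \<in> fill A" "z \<in> fill A" "fst z = fst y" "triggers x z"
    unfolding fill_def[of "fill A"] by blast
  have none: "\<not> triggers x' z'" if "x' \<in> A" "z' \<in> A" "fst z' = fst y" for x' z'
    using that y unfolding fill_def by blast
  obtain x' z' where xz': "x' \<in> A" "z' \<in> A" "fst x' = fst x" "fst z' = fst z"
    using in_fillD xz(1,2) by blast
  then have "fst x = fst z" "x \<noteq> z"
    using none xz(3,4) unfolding triggers_def by metis+
  moreover have "w \<in> A" if "w \<in> fill A" "fst w = fst y" for w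
    using that none unfolding fill_def by auto
  ultimately show False
    using none xz by simp
qed

lemma fill_in_carrier: "A \<subseteq> P \<times> UNIV \<Longrightarrow> fill A \<in> carrier L"
  by (auto simp: L_def fill_fill dest!: in_fillD)

lemma carrier_L_iff: "A \<in> carrier L \<longleftrightarrow> A \<subseteq> P \<times> UNIV \<and> fill A \<subseteq> A"
  using subset_fill[of A] by (auto simp: L_def)

lemma Int_in_carrier: "A \<in> carrier L \<Longrightarrow> B \<in> carrier L \<Longrightarrow> A \<inter> B \<in> carrier L"
  using fill_mono[of "A \<inter> B" A] fill_mono[of "A \<inter> B" B] unfolding carrier_L_iff by blast

lemma le_L [simp]: "A \<sqsubseteq>\<^bsub>L\<^esub> B \<longleftrightarrow> A \<subseteq> B"
  by (simp add: L_def)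

section \<open>Lattice operations on closed sets\<close>

lemma least_fill:
  assumes A: "A \<in> carrier L" and B: "B \<in> carrier L"
  shows "least L (fill (A \<union> B)) (Upper L {A, B})"
proof (rule least_UpperI)
  show "fill (A \<union> B) \<sqsubseteq>\<^bsub>L\<^esub> C" if "C \<in> Upper L {A, B}" for C
  proof -
    have "A \<union> B \<subseteq> C" "C \<in> carrier L"
      using that A B by (auto simp: Upper_def)
    then show ?thesis
      using fill_mono[of "A \<union> B" C] by (auto simp: carrier_L_iff)
  qed
  show "fill (A \<union> B) \<in> carrier L"
    using A B by (intro fill_in_carrier) (simp add: carrier_L_iff)
qed (use A B subset_fill[of "A \<union> B"] in auto)

lemma greatest_Int:
  assumes "A \<in> carrier L" "B \<in> carrier L"
  shows "greatest L (A \<inter> B) (Lower L {A, B})"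
  using assms Int_in_carrier[OF assms] by (intro greatest_LowerI) (auto simp: Lower_def)

lemma lattice_L: "lattice L"
proof -
  interpret partial_order L
    by unfold_locales (auto simp: L_def)
  show ?thesis
    by unfold_locales (use least_fill greatest_Int in blast)+
qed

sublocale L: lattice L
  by (rule lattice_L)

lemma join_eq: "A \<in> carrier L \<Longrightarrow> B \<in> carrier L \<Longrightarrow> A \<squnion>\<^bsub>L\<^esub> B = fill (A \<union> B)"
  using L.weak_least_unique[OF L.sup_of_two_least least_fill]
  by (simp add: L.eq_is_equal join_def)

lemma meet_eq: "A \<in> carrier L \<Longrightarrow> B \<in> carrier L \<Longrightarrow> A \<sqinter>\<^bsub>L\<^esub> B = A \<inter> B"
  using L.weak_greatest_unique[OF L.inf_of_two_greatest greatest_Int]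
  by (simp add: L.eq_is_equal meet_def)

lemma finite_lattice_L: "finite_lattice L"
proof
  have "finite (P \<times> (UNIV :: Enum.finite_3 set))"
    using finite_P by simp
  then show "finite (carrier L)"
    by (rule finite_subset[rotated, OF finite_Pow_iff[THEN iffD2]]) (auto simp: L_def)
  show "carrier L \<noteq> {}"
    using fill_in_carrier[of "{}"] by blast
qed

section \<open>Special closed sets and the congruences given by down-sets\<close>

lemma empty_in_carrier: "{} \<in> carrier L"
  using fill_in_carrier[of "{}"] by (simp add: fill_def)

lemma singleton_in_carrier: "p \<in> P \<Longrightarrow> {(p, i)} \<in> carrier L"
  using irrefl by (auto simp: L_def fill_def triggers_def)

lemma fibres_in_carrier: "I \<subseteq> P \<Longrightarrow> I \<times> UNIV \<in> carrier L"
  by (auto simp: L_def fill_def)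

text \<open>Triggering stays in a fibre or passes to a lower one, so with \<open>I\<close> a
  down-set a point outside \<open>I\<close> is triggered only by points outside \<open>I\<close>.
  Hence the part of a join outside \<open>I\<close> depends only on the parts of its arguments
  outside \<open>I\<close>. Meets are intersections.\<close>

lemma congruence_agree_outside:
  assumes I: "down_set I"
  shows "lattice_congruence L (agree_outside I)"
proof -
  have le: "fill (A \<union> C) \<subseteq> fill (B \<union> D) \<union> I \<times> UNIV"
    if "(A, B) \<in> agree_outside I" "(C, D) \<in> agree_outside I" for A B C D
  proof
    fix y assume y: "y \<in> fill (A \<union> C)"
    have sub: "A \<union> C \<subseteq> P \<times> UNIV"
      using that by (auto simp: agree_outside_def L_def)
    have eq: "x \<in> A \<union> C \<longleftrightarrow> x \<in> B \<union> D" if "fst x \<notin> I" for x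
      using \<open>(A, B) \<in> _\<close> \<open>(C, D) \<in> _\<close> that unfolding agree_outside_iff by blast
    show "y \<in> fill (B \<union> D) \<union> I \<times> UNIV"
    proof (cases "fst y \<in> I \<or> y \<in> A \<union> C")
      case True
      then show ?thesis
        using eq[of y] subset_fill[of "B \<union> D"] by (cases y) auto
    next
      case False
      then obtain x z where xz: "x \<in> A \<union> C" "z \<in> A \<union> C" "fst z = fst y" "triggers x z"
        using y by (auto simp: fill_def)
      moreover have "fst z \<notin> I"
        using False xz by simp
      moreover from this have "fst x \<notin> I"
        using xz I sub by (auto simp: triggers_def down_set_def)
      ultimately show ?thesis
        using eq by (auto simp: fill_def)
    qed
  qed
  have sym: "(B, A) \<in> agree_outside I" if "(A, B) \<in> agree_outside I" for A B
    using that by (simp add: agree_outside_iff)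
  have join: "(fill (A \<union> C), fill (B \<union> D)) \<in> agree_outside I"
    if "(A, B) \<in> agree_outside I" "(C, D) \<in> agree_outside I" for A B C D
    unfolding agree_outside_iff
  proof (intro conjI allI impI)
    show "fill (A \<union> C) \<in> carrier L" "fill (B \<union> D) \<in> carrier L"
      using that L.join_closed[of A C] L.join_closed[of B D]
      by (simp_all add: agree_outside_iff join_eq)
    show "x \<in> fill (A \<union> C) \<longleftrightarrow> x \<in> fill (B \<union> D)" if "fst x \<notin> I" for x
      using le[of A B C D] le[of B A D C] sym \<open>(A, B) \<in> _\<close> \<open>(C, D) \<in> _\<close> that by (cases x) auto
  qed
  have "(A \<squnion>\<^bsub>L\<^esub> C, B \<squnion>\<^bsub>L\<^esub> D) \<in> agree_outside I \<and> (A \<sqinter>\<^bsub>L\<^esub> C, B \<sqinter>\<^bsub>L\<^esub> D) \<in> agree_outside I"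
    if "(A, B) \<in> agree_outside I" "(C, D) \<in> agree_outside I" for A B C D
  proof
    have ABCD: "A \<in> carrier L" "B \<in> carrier L" "C \<in> carrier L" "D \<in> carrier L"
      using that by (auto simp: agree_outside_iff)
    show "(A \<squnion>\<^bsub>L\<^esub> C, B \<squnion>\<^bsub>L\<^esub> D) \<in> agree_outside I"
      using join[OF that] ABCD by (simp add: join_eq)
    show "(A \<sqinter>\<^bsub>L\<^esub> C, B \<sqinter>\<^bsub>L\<^esub> D) \<in> agree_outside I"
      using that ABCD by (simp add: agree_outside_iff meet_eq Int_in_carrier)
  qed
  moreover have "equiv (carrier L) (agree_outside I)"
    by (auto simp: equiv_def refl_on_def sym_def trans_def agree_outside_def)
  ultimately show ?thesis
    by (simp add: lattice_congruence_def)
qed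

lemma agree_outside_subset_iff:
  assumes "I \<subseteq> P"
  shows "agree_outside I \<subseteq> agree_outside I' \<longleftrightarrow> I \<subseteq> I'"
proof
  assume sub: "agree_outside I \<subseteq> agree_outside I'"
  show "I \<subseteq> I'"
  proof
    fix p assume "p \<in> I"
    \<comment> \<open>This pair differs only at \<open>(p, i)\<close>; as it also lies in
      \<open>agree_outside I'\<close>, the element \<open>p\<close> must belong to
      \<open>I'\<close>.\<close>
    then have "({}, {(p, i)}) \<in> agree_outside I" for i
      using assms empty_in_carrier singleton_in_carrier by (auto simp: agree_outside_def)
    then show "p \<in> I'"
      using sub by (fastforce simp: agree_outside_def)
  qed
qed (auto simp: agree_outside_def)

section \<open>Every congruence comes from a down-set\<close>

lemma third_index: "\<exists>k :: Enum.finite_3. k \<noteq> i \<and> k \<noteq> j"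
proof -
  have "card {i, j} < card (UNIV :: Enum.finite_3 set)"
    by (auto simp: UNIV_finite_3 card_insert_if)
  then have "{i, j} \<noteq> UNIV" by auto
  then show ?thesis by blast
qed

text \<open>The set \<open>I\<close> collects the elements with an atom congruent to
  \<open>{}\<close>. Collapse spreads over a fibre and to lower fibres, so \<open>I\<close> is a
  down-set and \<open>I \<times> UNIV\<close> is congruent to \<open>{}\<close>. Meets with
  singletons then show that congruent sets differ only over \<open>I\<close>; joins with
  \<open>I \<times> UNIV\<close> give the converse.\<close>

lemma congruence_eq_agree_outside:
  assumes cong: "lattice_congruence L \<theta>"
  shows "\<exists>I. down_set I \<and> \<theta> = agree_outside I"
proof -
  have sub: "\<And>A B. (A, B) \<in> \<theta> \<Longrightarrow> A \<in> carrier L \<and> B \<in> carrier L"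
    using lattice_congruence_subset[OF cong] by auto
  have refl: "\<And>A. A \<in> carrier L \<Longrightarrow> (A, A) \<in> \<theta>"
    and sym: "\<And>A B. (A, B) \<in> \<theta> \<Longrightarrow> (B, A) \<in> \<theta>"
    and trans: "\<And>A B C. \<lbrakk>(A, B) \<in> \<theta>; (B, C) \<in> \<theta>\<rbrakk> \<Longrightarrow> (A, C) \<in> \<theta>"
    using cong unfolding lattice_congruence_def equiv_def
    by (auto dest: refl_onD symD transD)
  have join: "(fill (A \<union> C), fill (B \<union> D)) \<in> \<theta>" and meet: "(A \<inter> C, B \<inter> D) \<in> \<theta>"
    if "(A, B) \<in> \<theta>" "(C, D) \<in> \<theta>" for A B C D
  proof -
    have "(A \<squnion>\<^bsub>L\<^esub> C, B \<squnion>\<^bsub>L\<^esub> D) \<in> \<theta>" "(A \<sqinter>\<^bsub>L\<^esub> C, B \<sqinter>\<^bsub>L\<^esub> D) \<in> \<theta>"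
      using cong that unfolding lattice_congruence_def by blast+
    then show "(fill (A \<union> C), fill (B \<union> D)) \<in> \<theta>" "(A \<inter> C, B \<inter> D) \<in> \<theta>"
      using sub[OF that(1)] sub[OF that(2)] by (simp_all add: join_eq meet_eq)
  qed
  note [simp] = empty_in_carrier singleton_in_carrier
  have collapse: "({}, {(q, k)}) \<in> \<theta>"
    if "({}, {(p, i)}) \<in> \<theta>" "q \<in> P" "below q p \<or> q = p" for p q i k
  proof (cases "(q, k) = (p, i)")
    case False
    \<comment> \<open>Join both sides with \<open>{(q, j)}\<close>, then meet with
      \<open>{(q, k)}\<close>. From \<open>{}\<close> this gives \<open>{}\<close>, since
      \<open>j \<noteq> k\<close>; from \<open>{(p, i)}\<close> it fills the fibre of
      \<open>q\<close> and gives \<open>{(q, k)}\<close>. For \<open>q = p\<close> the choice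
      \<open>j \<noteq> i\<close> provides the trigger, so simplicity of M_3 and descent to lower
      fibres are handled together.\<close>
    obtain j where j: "j \<noteq> i" "j \<noteq> k"
      using third_index by blast
    then have "(q, k) \<in> fill ({(p, i)} \<union> {(q, j)})"
      using that(3) by (auto simp: fill_def triggers_def)
    moreover have "fill ({} \<union> {(q, j)}) = {(q, j)}"
      using singleton_in_carrier[OF \<open>q \<in> P\<close>] by (simp add: L_def)
    moreover have "(fill ({} \<union> {(q, j)}) \<inter> {(q, k)}, fill ({(p, i)} \<union> {(q, j)}) \<inter> {(q, k)}) \<in> \<theta>"
      using that by (intro meet join refl) simp_all
    ultimately show ?thesis
      using j by simp
  qed (use that in simp)
  \<comment> \<open>One collapsed atom is enough here: \<open>collapse\<close> with
    \<open>q = p\<close> yields all atoms of the fibre.\<close>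
  define I where "I = {p \<in> P. \<exists>i. ({}, {(p, i)}) \<in> \<theta>}"
  have all: "({}, {(p, i)}) \<in> \<theta>" if "p \<in> I" for p i
    using that collapse by (auto simp: I_def)
  have I: "down_set I"
    using collapse by (auto simp: down_set_def I_def)
  \<comment> \<open>Fibres are added one at a time; a full fibre is the join of two of its atoms,
    both congruent to \<open>{}\<close>.\<close>
  have "({}, K \<times> UNIV) \<in> \<theta>" if "finite K" "K \<subseteq> I" for K
    using that
  proof (induction K)
    case empty
    then show ?case by (simp add: refl)
  next
    case (insert p K)
    obtain i j :: Enum.finite_3 where "j \<noteq> i"
      using third_index by blast
    have "(fill ({} \<union> {}), fill ({(p, i)} \<union> {(p, j)})) \<in> \<theta>"
      using insert all by (intro join) auto
    also have "fill ({} \<union> {}) = {}"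
      by (simp add: fill_def)
    also have "fill ({(p, i)} \<union> {(p, j)}) = {p} \<times> UNIV"
      using \<open>j \<noteq> i\<close> irrefl by (auto simp: fill_def triggers_def)
    finally have "(fill ({} \<union> {}), fill ({p} \<times> UNIV \<union> K \<times> UNIV)) \<in> \<theta>"
      using insert by (intro join) auto
    moreover have "fill ({p} \<times> UNIV \<union> K \<times> UNIV) = insert p K \<times> UNIV" "fill {} = {}"
      by (auto simp: fill_def)
    ultimately show ?case by simp
  qed
  then have fibres: "({}, I \<times> UNIV) \<in> \<theta>"
    using finite_P by (simp add: I_def)
  have "\<theta> \<subseteq> agree_outside I"
  proof -
    have "fst x \<in> I" if AB: "(A, B) \<in> \<theta>" and x: "x \<in> A" "x \<notin> B" for A B x
    proof -
      have "x \<in> P \<times> UNIV"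
        using sub[OF AB] x carrier_L_iff by blast
      \<comment> \<open>Meeting with \<open>{x}\<close> isolates a single point of difference and
        collapses that atom.\<close>
      then have "(A \<inter> {x}, B \<inter> {x}) \<in> \<theta>"
        using AB by (intro meet refl) auto
      then have "({}, {x}) \<in> \<theta>"
        using x sym by simp
      with \<open>x \<in> P \<times> UNIV\<close> show ?thesis
        by (auto simp: I_def)
    qed
    then show ?thesis
      using sub sym unfolding agree_outside_def by fast
  qed
  moreover have "agree_outside I \<subseteq> \<theta>"
  proof clarify
    fix A B assume AB: "(A, B) \<in> agree_outside I"
    \<comment> \<open>The union is already closed: what triggers a point outside \<open>I\<close>
      lies outside \<open>I\<close>, hence in the closed set \<open>C\<close>.\<close>
    have fill: "fill (C \<union> I \<times> UNIV) = C \<union> I \<times> UNIV" if "C \<in> carrier L" for C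
    proof -
      have "y \<in> C \<union> I \<times> UNIV"
        if y: "x \<in> C \<union> I \<times> UNIV" "z \<in> C \<union> I \<times> UNIV" "fst z = fst y" "triggers x z" for x y z
      proof (cases "fst y \<in> I")
        case False
        then have "z \<in> C"
          using y by (cases z) auto
        then have "fst z \<in> P"
          using \<open>C \<in> carrier L\<close> by (auto simp: carrier_L_iff)
        then have "fst x \<notin> I"
          using False y I by (auto simp: triggers_def down_set_def)
        then have "x \<in> C"
          using y by (cases x) auto
        then have "y \<in> fill C"
          using \<open>z \<in> C\<close> y unfolding fill_def by blast
        then show ?thesis
          using \<open>C \<in> carrier L\<close> by (auto simp: carrier_L_iff)
      qed (cases y, simp)
      then show ?thesis
        unfolding fill_def[of "C \<union> I \<times> UNIV"] by blast
    qed
    \<comment> \<open>Joining \<open>C\<close> with the collapsed fibres relates it to this union,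
      which is the same set for any two members agreeing outside \<open>I\<close>.\<close>
    have "(C, C \<union> I \<times> UNIV) \<in> \<theta>" if "C \<in> carrier L" for C
    proof -
      have "(fill (C \<union> {}), fill (C \<union> I \<times> UNIV)) \<in> \<theta>"
        using that fibres by (intro join refl)
      with fill[OF that] that show ?thesis
        by (simp add: L_def)
    qed
    moreover have "A \<union> I \<times> UNIV = B \<union> I \<times> UNIV" "A \<in> carrier L" "B \<in> carrier L"
      using AB by (auto simp: agree_outside_def)
    ultimately show "(A, B) \<in> \<theta>"
      by (metis trans sym)
  qed
  ultimately show ?thesis
    using I by blast
qed

section \<open>Every congruence is principal\<close>

lemma carrier_Con_L: "carrier (Con L) = agree_outside ` {I. down_set I}"
  using congruence_agree_outside congruence_eq_agree_outside by (auto simp: Con_def)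

lemma Princ_L: "Princ L = carrier (Con L)"
proof
  show "Princ L \<subseteq> carrier (Con L)"
    using con_least[OF lattice_L] by (auto simp: Princ_def least_def)
  show "carrier (Con L) \<subseteq> Princ L"
  proof
    fix \<theta> assume "\<theta> \<in> carrier (Con L)"
    then obtain I where I: "down_set I" and \<theta>: "\<theta> = agree_outside I"
      by (auto simp: carrier_Con_L)
    then have "I \<subseteq> P" by (simp add: down_set_def)
    have "con L {} (I \<times> UNIV) = agree_outside I"
    proof
      have "({}, I \<times> UNIV) \<in> agree_outside I"
        using fibres_in_carrier[OF \<open>I \<subseteq> P\<close>] empty_in_carrier by (auto simp: agree_outside_def)
      then show "con L {} (I \<times> UNIV) \<subseteq> agree_outside I"
        using congruence_agree_outside[OF I] by (auto simp: con_def)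
      show "agree_outside I \<subseteq> con L {} (I \<times> UNIV)"
        unfolding con_def
      proof (rule Inter_greatest, clarify del: subsetI)
        fix \<eta> assume "lattice_congruence L \<eta>" and \<eta>: "({}, I \<times> UNIV) \<in> \<eta>"
        \<comment> \<open>The sets \<open>{}\<close> and \<open>I \<times> UNIV\<close> differ at
          every point over \<open>I\<close>, so a congruence of this form relating them has
          \<open>I \<subseteq> I'\<close>.\<close>
        then obtain I' where I': "\<eta> = agree_outside I'"
          using congruence_eq_agree_outside by blast
        with \<eta> have "I \<subseteq> I'"
          by (force simp: agree_outside_def)
        then show "agree_outside I \<subseteq> \<eta>"
          using I' agree_outside_subset_iff[OF \<open>I \<subseteq> P\<close>] by simp
      qed
    qed
    then show "\<theta> \<in> Princ L"
      using \<theta> fibres_in_carrier[OF \<open>I \<subseteq> P\<close>] empty_in_carrier unfolding Princ_def by blast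
  qed
qed

end


section \<open>Join-irreducible elements\<close>

text \<open>Asking that \<open>x\<close> fail to lie below some element excludes the bottom without
  naming it.\<close>

definition join_irreducibles :: "('a, 'c) gorder_scheme \<Rightarrow> 'a set" where
  "join_irreducibles D = {x \<in> carrier D. (\<exists>y\<in>carrier D. \<not> x \<sqsubseteq>\<^bsub>D\<^esub> y) \<and>
     (\<forall>a\<in>carrier D. \<forall>b\<in>carrier D. x = a \<squnion>\<^bsub>D\<^esub> b \<longrightarrow> x = a \<or> x = b)}"

text \<open>Induction on the number of elements below \<open>x\<close>. If \<open>x\<close> is not
  join-irreducible, it is the bottom or a join of two strictly smaller elements, to which the
  induction hypothesis applies.\<close>

lemma (in finite_lattice) le_if_join_irreducibles_le:
  assumes "x \<in> carrier L" "y \<in> carrier L"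
    and "\<And>j. \<lbrakk>j \<in> join_irreducibles L; j \<sqsubseteq> x\<rbrakk> \<Longrightarrow> j \<sqsubseteq> y"
  shows "x \<sqsubseteq> y"
  using assms(1,3)
proof (induction "card {z \<in> carrier L. z \<sqsubseteq> x}" arbitrary: x rule: less_induct)
  case less
  have smaller: "a \<sqsubseteq> y" if a: "a \<in> carrier L" "a \<sqsubseteq> x" "a \<noteq> x" for a
  proof (rule less.hyps)
    have "x \<notin> {z \<in> carrier L. z \<sqsubseteq> a}"
      using a less.prems le_antisym by blast
    then have "{z \<in> carrier L. z \<sqsubseteq> a} \<subset> {z \<in> carrier L. z \<sqsubseteq> x}"
      using a less.prems le_trans by blast
    then show "card {z \<in> carrier L. z \<sqsubseteq> a} < card {z \<in> carrier L. z \<sqsubseteq> x}"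
      using finite_carrier by (intro psubset_card_mono) auto
    show "j \<sqsubseteq> y" if "j \<in> join_irreducibles L" "j \<sqsubseteq> a" for j
      using that a less.prems le_trans[of j a x] by (auto simp: join_irreducibles_def)
  qed fact
  show ?case
  proof (cases "x \<in> join_irreducibles L")
    case True
    then show ?thesis
      using less.prems by simp
  next
    case False
    then consider "x \<sqsubseteq> y"
      | a b where "a \<in> carrier L" "b \<in> carrier L" "x = a \<squnion> b" "x \<noteq> a" "x \<noteq> b"
      using less.prems assms(2) unfolding join_irreducibles_def by blast
    then show ?thesis
    proof cases
      case 2
      then show ?thesis
        using smaller[of a] smaller[of b] join_left[of a b] join_right[of a b] assms(2) join_le
        by simp
    qed
  qed
qed

text \<open>By distributivity \<open>j\<close> is the join of \<open>j \<sqinter> a\<close> and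
  \<open>j \<sqinter> b\<close>, hence equal to one of them; join-irreducible elements are thus
  join-prime.\<close>

lemma (in distributive_lattice) join_irreducible_le_join:
  assumes j: "j \<in> join_irreducibles L" and ab: "a \<in> carrier L" "b \<in> carrier L"
    and le: "j \<sqsubseteq> a \<squnion> b"
  shows "j \<sqsubseteq> a \<or> j \<sqsubseteq> b"
proof -
  have jL: "j \<in> carrier L"
    using j by (simp add: join_irreducibles_def)
  have "j = j \<sqinter> (a \<squnion> b)"
    using jL ab le by (intro le_antisym meet_le meet_left) auto
  then have "j = (j \<sqinter> a) \<squnion> (j \<sqinter> b)"
    using meet_join_distrib jL ab by simp
  then have "j = j \<sqinter> a \<or> j = j \<sqinter> b"
    using j meet_closed[OF jL ab(1)] meet_closed[OF jL ab(2)]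
    unfolding join_irreducibles_def mem_Collect_eq by blast
  then show ?thesis
    using meet_right[OF jL ab(1)] meet_right[OF jL ab(2)] by metis
qed

lemma (in finite_lattice) ex_bottom: "\<exists>x\<in>carrier L. \<forall>y\<in>carrier L. x \<sqsubseteq> y"
proof -
  have "\<exists>x\<in>carrier L. \<forall>y\<in>F. x \<sqsubseteq> y" if "finite F" "F \<subseteq> carrier L" for F
    using that
  proof (induction F)
    case empty
    then show ?case using carrier_nonempty by blast
  next
    case (insert a F)
    then obtain x where x: "x \<in> carrier L" "\<forall>y\<in>F. x \<sqsubseteq> y" and a: "a \<in> carrier L" "F \<subseteq> carrier L"
      by auto
    have "a \<sqinter> x \<sqsubseteq> y" if "y \<in> F" for y
      using that x a le_trans[OF meet_right[of a x], of y] by auto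
    then show ?case
      using x a meet_left[of a x] by (intro bexI[of _ "a \<sqinter> x"]) auto
  qed
  then show ?thesis
    using finite_carrier by blast
qed

text \<open>The element \<open>x\<close> is the join of \<open>F\<close>, built up from the bottom,
  which has no join-irreducible below it. By primeness, joining with \<open>i\<close> adds just the
  join-irreducibles below \<open>i\<close>. For a down-set \<open>F\<close> those below
  \<open>x\<close> are exactly the members of \<open>F\<close>.\<close>

lemma (in finite_distributive_lattice) ex_join_of_join_irreducibles:
  assumes "F \<subseteq> join_irreducibles L"
  shows "\<exists>x\<in>carrier L. \<forall>j\<in>join_irreducibles L. j \<sqsubseteq> x \<longleftrightarrow> (\<exists>i\<in>F. j \<sqsubseteq> i)"
proof -
  have "finite F"
    using assms by (intro finite_subset[OF _ finite_carrier]) (auto simp: join_irreducibles_def)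
  then show ?thesis
    using assms
  proof (induction F)
    case empty
    obtain x where "x \<in> carrier L" "\<forall>y\<in>carrier L. x \<sqsubseteq> y"
      using ex_bottom by blast
    moreover from this have "\<not> j \<sqsubseteq> x" if "j \<in> join_irreducibles L" for j
      using that le_trans[of j x] by (auto simp: join_irreducibles_def)
    ultimately show ?case by auto
  next
    case (insert i F)
    then obtain x where x: "x \<in> carrier L"
      "\<And>j. j \<in> join_irreducibles L \<Longrightarrow> j \<sqsubseteq> x \<longleftrightarrow> (\<exists>i\<in>F. j \<sqsubseteq> i)"
      by auto
    have i: "i \<in> carrier L"
      using insert by (auto simp: join_irreducibles_def)
    have "j \<sqsubseteq> i \<squnion> x \<longleftrightarrow> j \<sqsubseteq> i \<or> j \<sqsubseteq> x" if j: "j \<in> join_irreducibles L" for j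
    proof
      have "j \<in> carrier L"
        using j by (simp add: join_irreducibles_def)
      then show "j \<sqsubseteq> i \<squnion> x" if "j \<sqsubseteq> i \<or> j \<sqsubseteq> x"
        using that i x(1) join_left[of i x] join_right[of i x] le_trans[of j _ "i \<squnion> x"] by auto
    qed (use join_irreducible_le_join j i x in blast)
    then show ?case
      using i x by (intro bexI[of _ "i \<squnion> x"]) auto
  qed
qed

section \<open>Birkhoff's correspondence between \<open>D\<close> and down-sets, and the resulting
  isomorphism\<close>

theorem theorem2:
  fixes D :: "('d, 'e) gorder_scheme"
  assumes "finite_distributive_lattice D"
  shows "representable D (carrier D)"
proof -
  interpret D: finite_distributive_lattice D by fact
  let ?J = "join_irreducibles D"
  have J: "?J \<subseteq> carrier D"
    by (auto simp: join_irreducibles_def)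
  interpret finite_irreflexive ?J "\<lambda>p q. p \<sqsubseteq>\<^bsub>D\<^esub> q \<and> p \<noteq> q"
    by (rule finite_irreflexive.intro) (simp_all add: finite_subset[OF J D.finite_carrier])
  \<comment> \<open>Birkhoff's map from \<open>D\<close> to the down-sets of join-irreducibles,
    shown below to be an order isomorphism.\<close>
  define B where "B x = {j \<in> ?J. j \<sqsubseteq>\<^bsub>D\<^esub> x}" for x
  have down: "down_set (B x)" if "x \<in> carrier D" for x
    unfolding down_set_def
  proof (intro conjI ballI impI)
    fix p q assume "p \<in> B x" "q \<in> ?J" "q \<sqsubseteq>\<^bsub>D\<^esub> p \<and> q \<noteq> p"
    then show "q \<in> B x"
      using J D.le_trans[of q p x] that by (auto simp: B_def)
  qed (auto simp: B_def)
  have B_subset_iff: "B x \<subseteq> B y \<longleftrightarrow> x \<sqsubseteq>\<^bsub>D\<^esub> y" if "x \<in> carrier D" "y \<in> carrier D" for x y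
  proof
    assume "B x \<subseteq> B y"
    then show "x \<sqsubseteq>\<^bsub>D\<^esub> y"
      by (intro D.le_if_join_irreducibles_le[OF that]) (auto simp: B_def)
  next
    assume "x \<sqsubseteq>\<^bsub>D\<^esub> y"
    then show "B x \<subseteq> B y"
      using that J D.le_trans[of _ x y] by (auto simp: B_def)
  qed
  have B_surj: "\<exists>x\<in>carrier D. B x = I" if I: "down_set I" for I
  proof -
    obtain x where x: "x \<in> carrier D" "\<forall>j\<in>?J. j \<sqsubseteq>\<^bsub>D\<^esub> x \<longleftrightarrow> (\<exists>i\<in>I. j \<sqsubseteq>\<^bsub>D\<^esub> i)"
      using D.ex_join_of_join_irreducibles[of I] I by (auto simp: down_set_def)
    have "B x = I"
    proof
      show "B x \<subseteq> I"
      proof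
        fix j assume "j \<in> B x"
        then obtain i where "j \<in> ?J" "i \<in> I" "j \<sqsubseteq>\<^bsub>D\<^esub> i"
          using x by (auto simp: B_def)
        \<comment> \<open>Here \<open>down_set\<close> refers to the strict order, so
          \<open>j = i\<close> is a case of its own.\<close>
        then show "j \<in> I"
          using I by (cases "j = i") (auto simp: down_set_def)
      qed
      show "I \<subseteq> B x"
      proof
        fix j assume "j \<in> I"
        then have "j \<in> ?J" "j \<sqsubseteq>\<^bsub>D\<^esub> j"
          using I J by (auto simp: down_set_def)
        then show "j \<in> B x"
          using x \<open>j \<in> I\<close> by (auto simp: B_def)
      qed
    qed
    with x show ?thesis by blast
  qed
  let ?\<phi> = "\<lambda>x. agree_outside (B x)"
  have iff: "?\<phi> x \<sqsubseteq>\<^bsub>Con L\<^esub> ?\<phi> y \<longleftrightarrow> x \<sqsubseteq>\<^bsub>D\<^esub> y" if "x \<in> carrier D" "y \<in> carrier D" for x y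
  proof -
    have "B x \<subseteq> ?J"
      by (auto simp: B_def)
    then show ?thesis
      using agree_outside_subset_iff[of "B x" "B y"] B_subset_iff[OF that] by (simp add: Con_def)
  qed
  have im: "?\<phi> ` carrier D = carrier (Con L)"
  proof -
    have "B ` carrier D = {I. down_set I}"
      using down B_surj by blast
    then show ?thesis
      unfolding carrier_Con_L by (metis image_image)
  qed
  have "x = y" if "x \<in> carrier D" "y \<in> carrier D" "?\<phi> x = ?\<phi> y" for x y
    using iff[of x y] iff[of y x] that by (intro D.le_antisym) (simp_all add: Con_def)
  then have "inj_on ?\<phi> (carrier D)"
    by (rule inj_onI)
  with im have "lattice_iso D (Con L) ?\<phi>"
    by (intro order_iso_imp_lattice_iso D.lattice_axioms lattice_Con lattice_L iff)
      (simp_all add: bij_betw_def)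
  \<comment> \<open>With \<open>Q\<close> all of \<open>D\<close>, the image under
    \<open>?\<phi>\<close> is the whole congruence lattice, which equals
    \<open>Princ L\<close>.\<close>
  with finite_lattice_L show ?thesis
    by (rule representableI) (simp_all add: im Princ_L)
qed

end
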